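(* Let $G$ be a triangle-free cubic graph. Obtain a graph $H$ from $G$ by adding a new vertex $x$, joining $x$ by an edge to some vertex $y$ of $G$, and making $x$ adjacent to exactly two of the neighbors of $y$ in $G$. Then $H$ is $\mathrm{cl}$-expanding, i.e. $\lim_{k\to\infty}|V(\mathrm{cl}^k(H))|=\infty$.
   Context: Graphs are finite and simple. A claw in a graph $G$ is an induced subgraph of $G$ isomorphic to $K_{1,3}$. The claw graph $\mathrm{cl}(G)$ is the graph whose vertices are the claws in $G$, where two vertices are adjacent if and only if they are distinct claws sharing a common edge; if $G$ has no claw, $\mathrm{cl}(G)=\emptyset$, and $\mathrm{cl}(\emptyset)=\emptyset$. Iterates: $\mathrm{cl}^0(H)=H$, $\mathrm{cl}^k(H)=\mathrm{cl}(\mathrm{cl}^{k-1}(H))$. A cubic graph is a 3-regular graph; triangle-free means containing no subgraph isomorphic to $C_3$. *)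

theory Defs
  imports Complex_Main "HOL-Library.FSet" "Graph_Theory.Graph_Theory"
begin

text \<open>
  A finite simple graph is a \<^verbatim>\<open>pair_graph\<close>: a finite, symmetric, loop-free digraph without parallel
  arcs, so that an undirected edge is a pair of opposite arcs and the degree of a vertex is its
  out-degree.  The predicates \<^verbatim>\<open>K\<^bsub>n\<^esub>\<close> and \<^verbatim>\<open>K\<^bsub>m,n\<^esub>\<close> of the library express being isomorphic to the
  complete and complete bipartite graphs; note that the cycle of length 3 is the complete graph on
  3 vertices.
\<close>

definition cubic :: "'a pair_pre_digraph \<Rightarrow> bool" where
  "cubic G \<longleftrightarrow> (\<forall>v \<in> pverts G. out_degree (with_proj G) v = 3)"

definition triangle_free :: "'a pair_pre_digraph \<Rightarrow> bool" where
  "triangle_free G \<longleftrightarrow> \<not> (\<exists>T. subgraph T (with_proj G) \<and> K\<^bsub>3\<^esub> T)"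

definition claws :: "'a pair_pre_digraph \<Rightarrow> ('a, 'a \<times> 'a) pre_digraph set" where
  "claws G = {C. induced_subgraph C (with_proj G) \<and> K\<^bsub>1,3\<^esub> C}"

definition claw_graph :: "'a pair_pre_digraph \<Rightarrow> ('a, 'a \<times> 'a) pre_digraph pair_pre_digraph" where
  "claw_graph G =
    \<lparr> pverts = claws G,
      parcs = {(C, D). C \<in> claws G \<and> D \<in> claws G \<and> C \<noteq> D \<and> arcs C \<inter> arcs D \<noteq> {}} \<rparr>"

definition relabel :: "('a \<Rightarrow> 'b) \<Rightarrow> 'a pair_pre_digraph \<Rightarrow> 'b pair_pre_digraph" where
  "relabel f G = \<lparr> pverts = f ` pverts G, parcs = map_prod f f ` parcs G \<rparr>"

text \<open>
  The vertex type changes from \<^verbatim>\<open>G\<close> to \<^verbatim>\<open>claw_graph G\<close>, so the construction cannot be iterated as it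
  stands.  The following type is closed under forming claws: an induced subgraph is determined by
  its (finite) vertex set, which serves as the name of the claw.
\<close>

datatype 'a cvert = Base 'a | Claw "'a cvert fset"

definition claw_name :: "('a cvert, 'a cvert \<times> 'a cvert) pre_digraph \<Rightarrow> 'a cvert" where
  "claw_name C = Claw (Abs_fset (verts C))"

definition cl :: "'a cvert pair_pre_digraph \<Rightarrow> 'a cvert pair_pre_digraph" where
  "cl G = relabel claw_name (claw_graph G)"

definition cl_iter :: "nat \<Rightarrow> 'a pair_pre_digraph \<Rightarrow> 'a cvert pair_pre_digraph" where
  "cl_iter k H = (cl ^^ k) (relabel Base H)"

definition cl_expanding :: "'a pair_pre_digraph \<Rightarrow> bool" where
  "cl_expanding H \<longleftrightarrow> filterlim (\<lambda>k. card (pverts (cl_iter k H))) at_top sequentially"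

text \<open>The renaming is faithful: \<^verbatim>\<open>cl G\<close> is isomorphic to the claw graph of \<^verbatim>\<open>G\<close>.\<close>

lemma inj_on_claw_name: "inj_on claw_name (claws G)"
proof (rule inj_onI)
  fix C D
  assume C: "C \<in> claws G" and D: "D \<in> claws G" and eq: "claw_name C = claw_name D"
  have "graph C" "graph D"
    using C D by (auto simp: claws_def complete_bipartite_digraph_def)
  then have "finite (verts C)" "finite (verts D)"
    by (auto simp: graph_def digraph_def fin_digraph_def fin_digraph_axioms_def)
  then have v: "verts C = verts D"
    using eq by (simp add: claw_name_def Abs_fset_inject)
  have "arcs C = arcs D" "tail C = tail D" "head C = head D"
    using C D v
    by (auto simp: claws_def induced_subgraph_def subgraph_def compatible_def)
  with v show "C = D" by (intro pre_digraph.equality) auto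
qed

lemma digraph_iso_relabel:
  assumes wf: "pair_wf_digraph G" and inj: "inj_on f (pverts G)"
  shows "digraph_iso (with_proj G) (with_proj (relabel f G))"
proof -
  let ?h = "\<lparr> iso_verts = f, iso_arcs = map_prod f f, iso_head = snd, iso_tail = fst \<rparr>"
  have sub: "parcs G \<subseteq> pverts G \<times> pverts G"
    using wf by (auto dest: pair_wf_digraph.in_arcsD1 pair_wf_digraph.in_arcsD2)
  have "inj_on (map_prod f f) (parcs G)"
    using map_prod_inj_on[OF inj inj] sub by (rule inj_on_subset)
  then have "pre_digraph.digraph_isomorphism (with_proj G) ?h"
    using wf inj by (auto simp: pre_digraph.digraph_isomorphism_def wf_digraph_wp_iff)
  moreover have "with_proj (relabel f G) = app_iso ?h (with_proj G)"
    by (simp add: app_iso_def with_proj_def relabel_def)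
  ultimately show ?thesis by (auto simp: digraph_iso_def)
qed

lemma digraph_iso_cl: "digraph_iso (with_proj (claw_graph G)) (with_proj (cl G))"
  unfolding cl_def
proof (rule digraph_iso_relabel)
  show "pair_wf_digraph (claw_graph G)"
    by (auto simp: pair_wf_digraph_def claw_graph_def)
  show "inj_on claw_name (pverts (claw_graph G))"
    using inj_on_claw_name by (simp add: claw_graph_def)
qed

end

theory Submission
  imports Defs
begin

text \<open>
  Say that a vertex \<open>d\<close> is a partial twin of type \<open>(v, u)\<close> over a copy of \<open>G\<close> if, within that copy, it
  is adjacent to \<open>v\<close> and to all neighbours of \<open>v\<close> except \<open>u\<close>.  The new vertex \<open>x\<close> of \<open>H\<close> is a partial
  twin of type \<open>(y, c)\<close>, where \<open>c\<close> is the third neighbour of \<open>y\<close>.  Since \<open>G\<close> is cubic and triangle-free,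
  its vertices correspond to its claws, and these form again a copy of \<open>G\<close> in the claw graph.  If \<open>d\<close> has
  type \<open>(u, t)\<close>, then for each of the two neighbours \<open>v \<noteq> t\<close> of \<open>u\<close>, replacing \<open>u\<close> by \<open>d\<close> in the claw
  centred at \<open>v\<close> gives another claw, which is a partial twin of type \<open>(v, u)\<close> over the new copy.  Hence
  the number of partial twins at least doubles with every step.  Adjacencies between partial twins never
  matter, because each of these claws contains at most one of them.
\<close>

text \<open>A claw is handled as a centre with its leaf set, so that sharing an edge in the claw
  graph turns into membership conditions on centres and leaves.\<close>

definition claw_at :: "'a pair_pre_digraph \<Rightarrow> 'a \<Rightarrow> 'a set \<Rightarrow> bool" where
  "claw_at K c L \<longleftrightarrow> card L = 3 \<and> (\<forall>l\<in>L. (c, l) \<in> parcs K) \<and> (\<forall>l\<in>L. \<forall>l'\<in>L. (l, l') \<notin> parcs K)"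

definition star :: "'a cvert \<Rightarrow> 'a cvert set \<Rightarrow> 'a cvert" where
  "star c L = Claw (Abs_fset (insert c L))"

definition claw_digraph :: "'a \<Rightarrow> 'a set \<Rightarrow> ('a, 'a \<times> 'a) pre_digraph" where
  "claw_digraph c L = with_proj \<lparr> pverts = insert c L, parcs = {c} \<times> L \<union> L \<times> {c} \<rparr>"

section \<open>Finite simple graphs and their claw graphs\<close>

lemma pair_graph_symD: "pair_graph K \<Longrightarrow> (u, v) \<in> parcs K \<Longrightarrow> (v, u) \<in> parcs K"
  by (meson pair_graph.axioms(2) pair_pseudo_graph.axioms(2) pair_sym_digraph.arcs_symmetric)

lemma pair_graph_loopfree: "pair_graph K \<Longrightarrow> (u, u) \<notin> parcs K"
  by (metis fst_conv snd_conv pair_graph.axioms(1) pair_digraph.axioms(2)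
      pair_loopfree_digraph.pair_no_loops)

lemma pair_graph_arcD:
  assumes "pair_graph K" "(u, v) \<in> parcs K"
  shows "u \<in> pverts K" "v \<in> pverts K"
proof -
  interpret pair_graph K by fact
  show "u \<in> pverts K" "v \<in> pverts K"
    using assms(2) in_arcsD1 in_arcsD2 by blast+
qed

lemma pair_graphI:
  assumes "finite (pverts K)" "parcs K \<subseteq> pverts K \<times> pverts K"
    and "\<And>u v. (u, v) \<in> parcs K \<Longrightarrow> (v, u) \<in> parcs K" "\<And>u. (u, u) \<notin> parcs K"
  shows "pair_graph K"
proof -
  have "finite (parcs K)"
    using assms(1,2) by (meson finite_SigmaI finite_subset)
  with assms show ?thesis
    by unfold_locales (auto simp: symmetric_def intro!: symI)
qed

lemma pair_graph_relabel:
  assumes "pair_graph K" "inj_on f (pverts K)"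
  shows "pair_graph (relabel f K)"
proof (rule pair_graphI)
  interpret pair_graph K by fact
  show "finite (pverts (relabel f K))"
    by (simp add: relabel_def pair_finite_verts)
  show "parcs (relabel f K) \<subseteq> pverts (relabel f K) \<times> pverts (relabel f K)"
    by (auto simp: relabel_def dest: in_arcsD1 in_arcsD2)
  show "(v, u) \<in> parcs (relabel f K)" if "(u, v) \<in> parcs (relabel f K)" for u v
    using that arcs_symmetric by (force simp: relabel_def map_prod_def)
  show "(u, u) \<notin> parcs (relabel f K)" for u
    using assms pair_graph_loopfree[OF assms(1)]
    by (auto simp: relabel_def dest: in_arcsD1 in_arcsD2 inj_onD)
qed

text \<open>Only finiteness needs an argument: an induced subgraph is determined by its vertex set,
  so the claws inject into the subsets of \<open>pverts K\<close>.\<close>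

lemma pair_graph_claw_graph:
  assumes "pair_graph K"
  shows "pair_graph (claw_graph K)"
proof (rule pair_graphI)
  interpret pair_graph K by fact
  have "verts ` claws K \<subseteq> Pow (pverts K)"
    by (auto simp: claws_def induced_subgraph_def subgraph_def)
  then have "finite (verts ` claws K)"
    using pair_finite_verts by (meson finite_Pow_iff finite_subset)
  moreover have "inj_on verts (claws K)"
    by (auto simp: inj_on_def claws_def induced_subgraph_def subgraph_def compatible_def
        intro!: pre_digraph.equality)
  ultimately show "finite (pverts (claw_graph K))"
    by (simp add: claw_graph_def finite_image_iff)
qed (auto simp: claw_graph_def)

lemma pair_graph_cl: "pair_graph K \<Longrightarrow> pair_graph (cl K)"
  unfolding cl_def
  by (rule pair_graph_relabel[OF pair_graph_claw_graph])
     (simp_all add: claw_graph_def inj_on_claw_name)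

section \<open>Claws by centre and leaves, and their adjacency in \<open>cl\<close>\<close>

lemma claw_at_finite: "claw_at K c L \<Longrightarrow> finite L"
  by (simp add: claw_at_def card_ge_0_finite)

lemma claw_at_center_notin: "pair_graph K \<Longrightarrow> claw_at K c L \<Longrightarrow> c \<notin> L"
  by (auto simp: claw_at_def pair_graph_loopfree)

text \<open>One direction suffices: the vertices of the iterates are only bounded from below, so it
  is enough to exhibit claws.\<close>

lemma claw_digraph_in_claws:
  assumes K: "pair_graph K" and c: "claw_at K c L"
  shows "claw_digraph c L \<in> claws K"
proof -
  let ?C = "\<lparr> pverts = insert c L, parcs = {c} \<times> L \<union> L \<times> {c} \<rparr>"
  have cL: "c \<notin> L" "finite L" "card L = 3"
    using claw_at_center_notin[OF K c] claw_at_finite[OF c] c by (auto simp: claw_at_def)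
  have bip: "K\<^bsub>1,3\<^esub> (with_proj ?C)"
    unfolding complete_bipartite_digraph_pair_def
    by (insert cL, rule conjI, simp, rule exI[of _ "{c}"], rule exI[of _ L]) auto
  have wf: "wf_digraph (with_proj ?C)" "wf_digraph (with_proj K)"
    using K by (auto simp: wf_digraph_wp_iff pair_wf_digraph_def pair_graph_def
        pair_digraph_def pair_fin_digraph_def)
  \<comment> \<open>The centre is known to be a vertex only as the tail of an arc to some
    leaf.\<close>
  have "L \<noteq> {}" using cL(3) by auto
  then have vs: "insert c L \<subseteq> pverts K"
    using c pair_graph_arcD[OF K] by (auto simp: claw_at_def)
  have arcs: "{c} \<times> L \<union> L \<times> {c} = {r \<in> parcs K. fst r \<in> insert c L \<and> snd r \<in> insert c L}"
    using c pair_graph_symD[OF K] pair_graph_loopfree[OF K] by (auto simp: claw_at_def)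
  have "induced_subgraph (with_proj ?C) (with_proj K)"
    unfolding induced_subgraph_def subgraph_def
  proof (intro conjI wf)
    show "arcs (with_proj ?C) \<subseteq> arcs (with_proj K)"
      using arcs by auto
    show "arcs (with_proj ?C) = {r \<in> arcs (with_proj K). tail (with_proj K) r \<in> verts (with_proj ?C) \<and>
        head (with_proj K) r \<in> verts (with_proj ?C)}"
      using arcs by simp
  qed (use vs in \<open>simp_all add: compatible_def\<close>)
  with bip show ?thesis by (simp add: claws_def claw_digraph_def)
qed

lemma claw_name_claw_digraph: "claw_name (claw_digraph c L) = star c L"
  by (simp add: claw_name_def claw_digraph_def star_def)

lemma star_in_cl:
  assumes "pair_graph K" "claw_at K c L"
  shows "star c L \<in> pverts (cl K)"
  using claw_digraph_in_claws[OF assms]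
  by (auto simp: cl_def relabel_def claw_graph_def simp flip: claw_name_claw_digraph)

text \<open>The name keeps only the vertex set, yet the centre can be recovered. If \<open>c\<close>
  and \<open>c'\<close> differ, then \<open>c\<close> is a leaf of the second claw, and so is any
  leaf of \<open>c\<close> other than \<open>c'\<close>; but these two are adjacent.\<close>

lemma star_eq_iff:
  assumes K: "pair_graph K" and 1: "claw_at K c L" and 2: "claw_at K c' L'"
  shows "star c L = star c' L' \<longleftrightarrow> c = c' \<and> L = L'"
proof
  assume "star c L = star c' L'"
  then have eq: "insert c L = insert c' L'"
    using claw_at_finite[OF 1] claw_at_finite[OF 2] by (simp add: star_def Abs_fset_inject)
  have "c = c'"
  proof (rule ccontr)
    assume "c \<noteq> c'"
    have "\<not> L \<subseteq> {c'}"
      using 1 card_mono[of "{c'}" L] by (auto simp: claw_at_def)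
    then obtain l where "l \<in> L" "l \<noteq> c'" by blast
    then have "c \<in> L'" "l \<in> L'" "(c, l) \<in> parcs K"
      using eq \<open>c \<noteq> c'\<close> 1 by (auto simp: claw_at_def)
    then show False using 2 by (auto simp: claw_at_def)
  qed
  then show "c = c' \<and> L = L'"
    using eq claw_at_center_notin[OF K 1] claw_at_center_notin[OF K 2] by auto
qed simp

text \<open>Every edge of a claw contains its centre. Hence claws with different centres can share
  only the edge joining the two centres, and claws with the same centre share an edge exactly when
  they share a leaf.\<close>

lemma star_arc_iff:
  assumes K: "pair_graph K" and 1: "claw_at K c L" and 2: "claw_at K c' L'"
  shows "(star c L, star c' L') \<in> parcs (cl K) \<longleftrightarrow>
    (c \<noteq> c' \<or> L \<noteq> L') \<and> (c = c' \<and> L \<inter> L' \<noteq> {} \<or> c \<in> L' \<and> c' \<in> L)"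
proof -
  let ?C = "claw_digraph c L" and ?D = "claw_digraph c' L'"
  have mem: "?C \<in> claws K" "?D \<in> claws K"
    using claw_digraph_in_claws[OF K] 1 2 by auto
  have "(star c L, star c' L') \<in> parcs (cl K) \<longleftrightarrow> (?C, ?D) \<in> parcs (claw_graph K)"
    using mem inj_on_claw_name[of K]
    by (force simp: cl_def relabel_def claw_graph_def inj_on_eq_iff
        simp flip: claw_name_claw_digraph)
  also have "\<dots> \<longleftrightarrow> star c L \<noteq> star c' L' \<and> arcs ?C \<inter> arcs ?D \<noteq> {}"
    using mem inj_on_claw_name[of K]
    by (auto simp: claw_graph_def inj_on_eq_iff simp flip: claw_name_claw_digraph)
  also have "arcs ?C \<inter> arcs ?D \<noteq> {} \<longleftrightarrow> c = c' \<and> L \<inter> L' \<noteq> {} \<or> c \<in> L' \<and> c' \<in> L"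
    by (auto simp: claw_digraph_def)
  finally show ?thesis using star_eq_iff[OF assms] by auto
qed

section \<open>Graphs containing a copy of \<open>G\<close> with partial twins\<close>

text \<open>The map \<open>e\<close> is the copy of \<open>G\<close> in \<open>K\<close>, and a
  triple in \<open>R\<close> is a partial twin followed by its type. Injectivity of
  \<open>fst\<close> on \<open>R\<close> gives each twin a single type, so that
  \<open>card R\<close> counts vertices of \<open>K\<close>.\<close>

definition doubled ::
  "'a pair_pre_digraph \<Rightarrow> 'b pair_pre_digraph \<Rightarrow> ('a \<Rightarrow> 'b) \<Rightarrow> ('b \<times> 'a \<times> 'a) set \<Rightarrow> bool" where
  "doubled G K e R \<longleftrightarrow>
     inj_on e (pverts G) \<and> inj_on fst R \<and> e ` pverts G \<inter> fst ` R = {} \<and>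
     e ` pverts G \<union> fst ` R \<subseteq> pverts K \<and>
     (\<forall>v\<in>pverts G. \<forall>w\<in>pverts G. (e v, e w) \<in> parcs K \<longleftrightarrow> (v, w) \<in> parcs G) \<and>
     (\<forall>(d, v, u)\<in>R. (v, u) \<in> parcs G \<and>
        (\<forall>w\<in>pverts G. (e w, d) \<in> parcs K \<longleftrightarrow> w = v \<or> (v, w) \<in> parcs G \<and> w \<noteq> u))"

text \<open>Serves the start of the iteration, where \<open>Base\<close> carries \<open>H\<close>
  into the type closed under \<open>cl\<close>.\<close>

lemma doubled_relabel:
  assumes D: "doubled G K e R" and f: "inj f"
  shows "doubled G (relabel f K) (f \<circ> e) (apfst f ` R)"
proof -
  have arc: "(f p, f q) \<in> parcs (relabel f K) \<longleftrightarrow> (p, q) \<in> parcs K" for p q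
    using f by (auto simp: relabel_def inj_eq)
  have fst_apfst: "fst ` apfst f ` R = f ` fst ` R"
    by (simp add: image_image)
  show ?thesis
    unfolding doubled_def fst_apfst image_comp [symmetric]
  proof (intro conjI)
    show "inj_on (f \<circ> e) (pverts G)"
      using D inj_on_subset[OF f] by (auto simp: doubled_def intro: comp_inj_on)
    have "inj_on (f \<circ> fst) R"
      using D inj_on_subset[OF f] by (auto simp: doubled_def intro: comp_inj_on)
    then have "inj_on (fst \<circ> apfst f) R"
      by (simp add: comp_def)
    then show "inj_on fst (apfst f ` R)"
      by (rule inj_on_imageI)
    show "f ` e ` pverts G \<inter> f ` fst ` R = {}"
      using D f by (simp add: doubled_def flip: image_Int)
    show "f ` e ` pverts G \<union> f ` fst ` R \<subseteq> pverts (relabel f K)"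
      using D by (simp add: doubled_def relabel_def image_mono)
    show "\<forall>v\<in>pverts G. \<forall>w\<in>pverts G. ((f \<circ> e) v, (f \<circ> e) w) \<in> parcs (relabel f K) \<longleftrightarrow> (v, w) \<in> parcs G"
      using D by (simp add: arc doubled_def)
    show "\<forall>(d, v, u)\<in>apfst f ` R. (v, u) \<in> parcs G \<and>
        (\<forall>w\<in>pverts G. ((f \<circ> e) w, d) \<in> parcs (relabel f K) \<longleftrightarrow> w = v \<or> (v, w) \<in> parcs G \<and> w \<noteq> u)"
      using D by (simp add: arc doubled_def case_prod_beta)
  qed
qed

section \<open>Neighbourhoods in a triangle-free cubic graph\<close>

locale triangle_free_cubic =
  fixes G :: "'a pair_pre_digraph"
  assumes graph: "pair_graph G" and cubic: "cubic G" and tf: "triangle_free G"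
begin

definition N :: "'a \<Rightarrow> 'a set" where "N v = {w. (v, w) \<in> parcs G}"

lemma N_subset: "N v \<subseteq> pverts G"
  using pair_graph_arcD[OF graph] by (auto simp: N_def)

lemma N_sym: "w \<in> N v \<Longrightarrow> v \<in> N w"
  using pair_graph_symD[OF graph] by (simp add: N_def)

lemma N_irrefl: "v \<notin> N v"
  using pair_graph_loopfree[OF graph] by (simp add: N_def)

lemma card_N:
  assumes "v \<in> pverts G"
  shows "card (N v) = 3"
proof -
  have "out_arcs (with_proj G) v = Pair v ` N v"
    by (auto simp: out_arcs_def N_def)
  then have "card (out_arcs (with_proj G) v) = card (N v)"
    by (simp add: card_image inj_on_def)
  then show ?thesis
    using cubic assms by (simp add: cubic_def out_degree_def)
qed

lemma finite_N: "v \<in> pverts G \<Longrightarrow> finite (N v)"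
  using card_N card_ge_0_finite by force

text \<open>Adjacent neighbours of \<open>v\<close> would span a triangle with \<open>v\<close>.
  This is what makes \<open>N v\<close> the leaf set of a claw centred at \<open>v\<close>.\<close>

lemma N_independent:
  assumes "u \<in> N v" "w \<in> N v"
  shows "w \<notin> N u"
proof
  assume "w \<in> N u"
  let ?T = "\<lparr> pverts = {u, v, w}, parcs = {(p, q). p \<in> {u, v, w} \<and> q \<in> {u, v, w} \<and> p \<noteq> q} \<rparr>"
  have d: "u \<noteq> v" "v \<noteq> w" "u \<noteq> w"
    using assms \<open>w \<in> N u\<close> N_irrefl by auto
  have "K\<^bsub>3\<^esub> (with_proj ?T)"
    unfolding complete_digraph_pair_def using d by auto
  moreover have "subgraph (with_proj ?T) (with_proj G)"
  proof -
    have "pair_wf_digraph ?T" by (auto simp: pair_wf_digraph_def)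
    moreover have "pair_wf_digraph G"
      using graph by (simp add: pair_graph_def pair_digraph_def pair_fin_digraph_def)
    moreover have "{u, v, w} \<subseteq> pverts G"
      using assms N_sym N_subset by blast
    moreover have "parcs ?T \<subseteq> parcs G"
      using assms \<open>w \<in> N u\<close> N_sym by (auto simp: N_def)
    ultimately show ?thesis by (auto simp: subgraph_def compatible_def wf_digraph_wp_iff)
  qed
  ultimately show False using tf by (auto simp: triangle_free_def)
qed

section \<open>One application of \<open>cl\<close> doubles the partial twins\<close>

lemma doubled_cl:
  fixes K :: "'b cvert pair_pre_digraph"
  assumes K: "pair_graph K" and D: "doubled G K e R" and fin: "finite R"
  obtains e' R' where "doubled G (cl K) e' R'" "finite R'" "card R' = 2 * card R"
proof -
  have inj: "inj_on e (pverts G)" and injR: "inj_on fst R"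
    and disj: "\<And>v r. v \<in> pverts G \<Longrightarrow> r \<in> R \<Longrightarrow> e v \<noteq> fst r"
    and adj: "\<And>v w. v \<in> pverts G \<Longrightarrow> w \<in> pverts G \<Longrightarrow> (e v, e w) \<in> parcs K \<longleftrightarrow> w \<in> N v"
    using D by (auto simp: doubled_def N_def)
  have R1: "u \<in> N v" "u \<in> pverts G" "v \<in> pverts G" if "(d, v, u) \<in> R" for d v u
    using D that pair_graph_arcD[OF graph] by (auto simp: doubled_def N_def)
  have R2: "(e w, d) \<in> parcs K \<longleftrightarrow> w = v \<or> w \<in> N v \<and> w \<noteq> u"
    if "(d, v, u) \<in> R" "w \<in> pverts G" for d v u w
    using D that by (auto simp: doubled_def N_def)
  have disj': "d \<notin> e ` A" if "(d, v, u) \<in> R" "A \<subseteq> pverts G" for d v u A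
    using disj that by force
  note e_in = inj_on_image_mem_iff[OF inj]

  \<comment> \<open>An index is an old twin \<open>d\<close> of type \<open>(u, t)\<close> together
    with one of the two admissible centres \<open>v\<close>.\<close>
  define I where "I = Sigma R (\<lambda>(d, u, t). N u - {t})"
  \<comment> \<open>Leaf sets of the claw at \<open>e v\<close>: \<open>base v\<close> inside the
    copy of \<open>G\<close>, and \<open>twin d v u\<close> with \<open>d\<close> in place of
    \<open>e u\<close>.\<close>
  define base where "base v = e ` N v" for v
  define twin where "twin d v u = insert d (e ` (N v - {u}))" for d v u
  define e' where "e' v = star (e v) (base v)" for v
  \<comment> \<open>The new type is \<open>(v, u)\<close>: the old centre \<open>u\<close> becomes
    the omitted neighbour, and \<open>t\<close> is forgotten.\<close>
  define h where "h = (\<lambda>((d, u, t :: 'a), v). (star (e v) (twin d v u), v, u))"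

  have I1: "v \<in> N u" "u \<in> N v" "v \<noteq> t" "v \<in> pverts G" "u \<in> pverts G" "t \<in> N u" "(d, u, t) \<in> R"
    if "((d, u, t), v) \<in> I" for d u t v
    using that N_sym N_subset R1 by (auto simp: I_def)
  have NV: "w \<in> pverts G" if "w \<in> N v" for v w
    using that N_subset by blast
  have sub: "N v - {u} \<subseteq> pverts G" for v u
    using N_subset by blast
  have indep: "(e w, e w') \<notin> parcs K" if "w \<in> N v" "w' \<in> N v" for v w w'
    using that N_independent[OF that] adj[OF NV[OF that(1)] NV[OF that(2)]] by simp

  have claw_base: "claw_at K (e v) (base v)" if v: "v \<in> pverts G" for v
    unfolding claw_at_def
  proof (intro conjI ballI)
    show "card (base v) = 3"
      using card_image[OF inj_on_subset[OF inj N_subset]] card_N[OF v] by (simp add: base_def)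
    show "(e v, l) \<in> parcs K" if "l \<in> base v" for l
      using that v by (auto simp: base_def adj NV)
    show "(l, l') \<notin> parcs K" if "l \<in> base v" "l' \<in> base v" for l l'
      using that indep by (auto simp: base_def)
  qed
  have claw_twin: "claw_at K (e v) (twin d v u)" if i: "((d, u, t), v) \<in> I" for d u t v
    unfolding claw_at_def
  proof (intro conjI ballI)
    note i1 = I1[OF i]
    have "card (e ` (N v - {u})) = 2"
      using card_image[OF inj_on_subset[OF inj sub]] card_N[OF i1(4)] i1(2) finite_N[OF i1(4)]
      by simp
    then show "card (twin d v u) = 3"
      using disj'[OF i1(7) sub] finite_N[OF i1(4)] by (simp add: twin_def)
    \<comment> \<open>For the leaf \<open>d\<close> this rests on the choice of \<open>v\<close> in
      \<open>N u\<close> different from \<open>t\<close>.\<close>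
    show "(e v, l) \<in> parcs K" if "l \<in> twin d v u" for l
      using that i1 R2[OF i1(7) i1(4)] by (auto simp: twin_def adj NV)
    \<comment> \<open>In the copy, \<open>d\<close> is adjacent only to \<open>e u\<close> and to
      images of neighbours of \<open>u\<close>. Here \<open>w\<close> is not \<open>u\<close>, and
      it is not in \<open>N u\<close> because \<open>u\<close> and \<open>w\<close> are both
      neighbours of \<open>v\<close>.\<close>
    have "(e w, d) \<notin> parcs K" if "w \<in> N v - {u}" for w
      using that R2[OF i1(7) NV[of w v]] N_independent[OF i1(2), of w] by blast
    moreover from this have "(d, e w) \<notin> parcs K" if "w \<in> N v - {u}" for w
      using that pair_graph_symD[OF K] by blast
    ultimately show "(l, l') \<notin> parcs K" if "l \<in> twin d v u" "l' \<in> twin d v u" for l l'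
      using that indep pair_graph_loopfree[OF K] by (auto simp: twin_def)
  qed

  have injh: "inj_on (fst \<circ> h) I"
  proof (rule inj_onI, clarify)
    fix d u t v d' u' t' v'
    assume i: "((d, u, t), v) \<in> I" "((d', u', t'), v') \<in> I"
      and "(fst \<circ> h) ((d, u, t), v) = (fst \<circ> h) ((d', u', t'), v')"
    then have "e v = e v'" and t: "twin d v u = twin d' v' u'"
      using star_eq_iff[OF K claw_twin[OF i(1)] claw_twin[OF i(2)]] by (auto simp: h_def)
    then have "v = v'" using inj_onD[OF inj _ I1(4)[OF i(1)] I1(4)[OF i(2)]] by blast
    moreover have "d = d'"
      using t disj'[OF I1(7)[OF i(1)] sub] unfolding twin_def by blast
    then have "(d, u, t) = (d', u', t')"
      using inj_onD[OF injR _ I1(7)[OF i(1)] I1(7)[OF i(2)]] by simp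
    ultimately show "((d, u, t) = (d', u', t')) \<and> v = v'" by simp
  qed

  have finI: "finite I"
    unfolding I_def using fin R1 finite_N by (intro finite_SigmaI) auto
  have cardI: "card I = 2 * card R"
  proof -
    have "card ((\<lambda>(d, u, t). N u - {t}) r) = 2" if "r \<in> R" for r
      using that card_N R1 finite_N by (cases r) auto
    moreover have "finite ((\<lambda>(d, u, t). N u - {t}) r)" if "r \<in> R" for r
      using that R1 finite_N by (cases r) auto
    ultimately show ?thesis using fin by (simp add: I_def mult.commute)
  qed

  have "doubled G (cl K) e' (h ` I)"
    unfolding doubled_def
  proof (intro conjI ballI)
    show "inj_on e' (pverts G)"
      using inj_onD[OF inj] star_eq_iff[OF K claw_base claw_base] by (intro inj_onI) (simp add: e'_def)
    show "inj_on fst (h ` I)"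
      using injh by (rule inj_on_imageI)
    \<comment> \<open>Again the leaf \<open>d\<close> outside the copy tells the two kinds of claws
      apart.\<close>
    have "star (e w) (base w) \<noteq> star (e v) (twin d v u)"
      if "w \<in> pverts G" "((d, u, t), v) \<in> I" for w d u t v
      using star_eq_iff[OF K claw_base[OF that(1)] claw_twin[OF that(2)]]
        disj'[OF I1(7)[OF that(2)] N_subset[of w]] unfolding base_def twin_def by blast
    then show "e' ` pverts G \<inter> fst ` h ` I = {}"
      by (fastforce simp: e'_def h_def)
    show "e' ` pverts G \<union> fst ` h ` I \<subseteq> pverts (cl K)"
      using star_in_cl[OF K claw_base] star_in_cl[OF K claw_twin] by (auto simp: e'_def h_def)
  next
    fix v w assume vw: "v \<in> pverts G" "w \<in> pverts G"
    show "(e' v, e' w) \<in> parcs (cl K) \<longleftrightarrow> (v, w) \<in> parcs G"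
    proof -
      have "e v \<in> base w \<longleftrightarrow> v \<in> N w" "e w \<in> base v \<longleftrightarrow> w \<in> N v"
        using vw by (simp_all add: base_def e_in N_subset)
      moreover have "v \<in> N w \<longleftrightarrow> w \<in> N v" using N_sym by blast
      moreover have "e v = e w \<longleftrightarrow> v = w" using inj_on_eq_iff[OF inj vw] .
      ultimately show ?thesis
        unfolding e'_def star_arc_iff[OF K claw_base[OF vw(1)] claw_base[OF vw(2)]]
        using N_irrefl by (auto simp: N_def)
    qed
  next
    fix r assume "r \<in> h ` I"
    then obtain d u t v where i: "((d, u, t), v) \<in> I"
      and r: "r = (star (e v) (twin d v u), v, u)"
      by (auto simp: h_def)
    note i1 = I1[OF i]
    have "(e' w, star (e v) (twin d v u)) \<in> parcs (cl K) \<longleftrightarrow> w = v \<or> w \<in> N v \<and> w \<noteq> u"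
      if w: "w \<in> pverts G" for w
    proof -
      have "d \<notin> base w" and dw: "d \<noteq> e w"
        using disj'[OF i1(7)] N_subset disj[OF w i1(7)] by (auto simp: base_def)
      then have ne: "base w \<noteq> twin d v u" by (auto simp: twin_def)
      have "card (N v - {u}) = 2" using card_N i1 finite_N by simp
      then have "N v - {u} \<noteq> {}" by (metis card.empty zero_neq_numeral)
      then have "base v \<inter> twin d v u \<noteq> {}"
        by (auto simp: base_def twin_def)
      moreover have "e w \<in> twin d v u \<longleftrightarrow> w \<in> N v \<and> w \<noteq> u"
        using dw e_in[OF w sub] by (auto simp: twin_def)
      moreover have "e v \<in> base w \<longleftrightarrow> v \<in> N w"
        using e_in[OF i1(4) N_subset] by (simp add: base_def)
      moreover have "v \<in> N w \<longleftrightarrow> w \<in> N v" using N_sym by blast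
      moreover have "e w = e v \<longleftrightarrow> w = v"
        using inj_on_eq_iff[OF inj w i1(4)] .
      ultimately show ?thesis
        unfolding e'_def star_arc_iff[OF K claw_base[OF w] claw_twin[OF i]]
        using ne N_irrefl[of v] by (cases "w = v") auto
    qed
    then show "case r of (d, v, u) \<Rightarrow> (v, u) \<in> parcs G \<and>
        (\<forall>w\<in>pverts G. (e' w, d) \<in> parcs (cl K) \<longleftrightarrow> w = v \<or> (v, w) \<in> parcs G \<and> w \<noteq> u)"
      using i1(2) by (simp add: r N_def)
  qed
  moreover have "card (h ` I) = card I"
    using injh by (intro card_image) (rule inj_on_imageI2)
  ultimately show ?thesis
    using that finI cardI by simp
qed

section \<open>Exponential growth of the iterates\<close>

lemma cl_expanding_if_doubled:
  assumes H: "pair_graph H" and D: "doubled G H e R" and "finite R" "R \<noteq> {}"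
  shows "cl_expanding H"
proof -
  have inv: "pair_graph (cl_iter k H) \<and>
      (\<exists>e R. doubled G (cl_iter k H) e R \<and> finite R \<and> 2 ^ k \<le> card R)" for k
  proof (induction k)
    case 0
    have H0: "pair_graph (relabel Base H)"
      using H by (intro pair_graph_relabel) (auto simp: inj_on_def)
    let ?R = "apfst Base ` R"
    have "doubled G (relabel Base H) (Base \<circ> e) ?R"
      using D by (rule doubled_relabel) (simp add: inj_def)
    moreover have "inj_on (apfst Base) R" by (auto simp: inj_on_def)
    then have "card ?R = card R" by (rule card_image)
    \<comment> \<open>One initial twin gives the bound \<open>2 ^ 0\<close> from which the doubling
      starts.\<close>
    moreover have "1 \<le> card R" using assms by (simp add: Suc_le_eq card_gt_0_iff)
    ultimately show ?case
      using H0 \<open>finite R\<close> by (auto simp: cl_iter_def intro!: exI[of _ "Base \<circ> e"] exI[of _ ?R])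
  next
    case (Suc k)
    then obtain e R where K: "pair_graph (cl_iter k H)"
      and R: "doubled G (cl_iter k H) e R" "finite R" "2 ^ k \<le> card R"
      by blast
    have step: "cl_iter (Suc k) H = cl (cl_iter k H)" by (simp add: cl_iter_def)
    obtain e' R' where "doubled G (cl (cl_iter k H)) e' R'" "finite R'" "card R' = 2 * card R"
      using doubled_cl[OF K R(1,2)] .
    then show ?case
      using R(3) pair_graph_cl[OF K] unfolding step by (intro conjI exI) auto
  qed
  have "2 ^ k \<le> card (pverts (cl_iter k H))" for k
  proof -
    obtain e R where K: "pair_graph (cl_iter k H)"
      and R: "doubled G (cl_iter k H) e R" "2 ^ k \<le> card R"
      using inv[of k] by blast
    have "card R = card (fst ` R)"
      using R(1) by (simp add: doubled_def card_image)
    also have "\<dots> \<le> card (pverts (cl_iter k H))"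
      using R(1) K
      by (intro card_mono) (auto simp: doubled_def pair_graph_def pair_digraph_def
          pair_fin_digraph_def pair_fin_digraph_axioms_def)
    finally show ?thesis using R(2) by simp
  qed
  then have "k \<le> card (pverts (cl_iter k H))" for k
    using less_exp[of k] by (meson less_imp_le order_trans)
  then show ?thesis
    unfolding cl_expanding_def
    by (intro filterlim_at_top_mono[OF filterlim_ident]) auto
qed

end

section \<open>The graph \<open>H\<close> as a copy of \<open>G\<close> with one partial
  twin\<close>

theorem theorem4:
  fixes G H :: "'a pair_pre_digraph" and x y a b :: 'a
  assumes "pair_graph G" and "cubic G" and "triangle_free G"
    and "x \<notin> pverts G" and "y \<in> pverts G"
    and "(y, a) \<in> parcs G" and "(y, b) \<in> parcs G" and "a \<noteq> b"
    and "H = \<lparr> pverts = insert x (pverts G),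
               parcs = parcs G \<union> {(x, y), (y, x), (x, a), (a, x), (x, b), (b, x)} \<rparr>"
  shows "cl_expanding H"
proof -
  interpret triangle_free_cubic G
    using assms(1-3) by (rule triangle_free_cubic.intro)
  have ab: "a \<in> N y" "b \<in> N y" using assms(6,7) by (simp_all add: N_def)
  then have "card (N y - {a, b}) = 1"
    using card_N[OF assms(5)] finite_N[OF assms(5)] \<open>a \<noteq> b\<close> by (simp add: card_Diff_subset)
  then obtain c where "N y - {a, b} = {c}" by (auto simp: card_1_singleton_iff)
  then have c: "N y = {a, b, c}" "c \<noteq> a" "c \<noteq> b" using ab by auto
  have V: "a \<in> pverts G" "b \<in> pverts G" "c \<in> pverts G"
    using c N_subset by auto
  \<comment> \<open>All arcs of \<open>H\<close> at \<open>x\<close> are therefore among the six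
    added ones, so \<open>G\<close> stays induced and the neighbours of \<open>x\<close> are exactly
    \<open>y\<close>, \<open>a\<close> and \<open>b\<close>.\<close>
  have xG: "(x, w) \<notin> parcs G" "(w, x) \<notin> parcs G" for w
    using assms(4) pair_graph_arcD[OF assms(1)] by blast+
  have ny: "a \<noteq> y" "b \<noteq> y" "c \<noteq> y"
    using c N_irrefl[of y] by auto
  have "pair_graph H"
  proof (rule pair_graphI)
    show "finite (pverts H)"
      using assms(1,9) by (simp add: pair_graph_def pair_digraph_def
          pair_fin_digraph_def pair_fin_digraph_axioms_def)
    show "parcs H \<subseteq> pverts H \<times> pverts H"
      using assms(5,9) V pair_graph_arcD[OF assms(1)] by auto
    show "(v, u) \<in> parcs H" if "(u, v) \<in> parcs H" for u v
      using that assms(9) pair_graph_symD[OF assms(1)] by auto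
    show "(u, u) \<notin> parcs H" for u
      using assms(4,5,9) V pair_graph_loopfree[OF assms(1)] by auto
  qed
  moreover have "doubled G H id {(x, y, c)}"
  proof -
    have "(y, w) \<in> parcs G \<longleftrightarrow> w \<in> {a, b, c}" for w
      using c(1) by (auto simp: N_def)
    then show ?thesis
      using assms(4,5,9) c(2,3) V xG ny by (auto simp: doubled_def)
  qed
  ultimately show ?thesis
    by (rule cl_expanding_if_doubled) auto
qed

end
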